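(* The following equalities hold for the ideals $\mathrm{Fin}\times\emptyset$, $\emptyset\times\mathrm{Fin}$, $\mathrm{Fin}\times\mathrm{Fin}$, $\mathrm{Sel}$, $\mathcal{ED}$ on $\omega\times\omega$: (a) $\mathtt{cof}^{\emptyset\times\mathrm{Fin}}(\mathrm{Fin}\times\emptyset)=\mathtt{cof}^{\mathrm{Sel}}(\mathrm{Fin}\times\emptyset)=\omega$. (b) $\mathtt{cof}^{\emptyset\times\mathrm{Fin}}(\mathrm{Fin}\times\mathrm{Fin})=\omega$ and $\mathtt{cof}^{\mathrm{Sel}}(\mathrm{Fin}\times\mathrm{Fin})=\mathfrak d$. (c) $\mathtt{cof}^{\mathrm{Fin}\times\emptyset}(\mathrm{Sel})=\mathfrak c$. (d) $\mathtt{cof}^{\mathrm{Fin}\times\emptyset}(\mathcal{ED})=\mathfrak c$ and $\mathtt{cof}^{\emptyset\times\mathrm{Fin}}(\mathcal{ED})=\mathtt{cof}^{\mathrm{Sel}}(\mathcal{ED})=\omega$.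
   Context: For ideals $\mathcal I,\mathcal J$ on the same infinite set, $\mathtt{cof}^{\mathcal J}(\mathcal I)=\min\{|\mathcal A|:\mathcal A\subseteq\mathcal I,\ \forall I\in\mathcal I\ \exists A\in\mathcal A\ I\setminus A\in\mathcal J\}$. For $I\subseteq\omega\times\omega$ and $n\in\omega$ let $I_n=\{m:(n,m)\in I\}$; $\forall^\infty n$ means "for all but finitely many $n$". The ideals are: $\mathrm{Fin}\times\emptyset=\{I\subseteq\omega\times\omega:\forall^\infty n\ I_n=\emptyset\}$; $\emptyset\times\mathrm{Fin}=\{I\subseteq\omega\times\omega:\forall n\ I_n\text{ is finite}\}$; $\mathrm{Fin}\times\mathrm{Fin}=\{I\subseteq\omega\times\omega:\forall^\infty n\ I_n\text{ is finite}\}$; $\mathrm{Sel}=\{I\subseteq\omega\times\omega:\exists k\in\omega\ \forall n\in\omega\ |I_n|<k\}$; $\mathcal{ED}=\{I\subseteq\omega\times\omega:\exists k\in\omega\ \forall^\infty n\in\omega\ |I_n|<k\}$. $\mathfrak d$ is the dominating number, i.e. the least cardinality of a family $D\subseteq{}^\omega\omega$ such that every $f\in{}^\omega\omega$ satisfies $f(n)\le g(n)$ for all but finitely many $n$, for some $g\in D$; $\mathfrak c=2^{\aleph_0}$. *)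

theory Defs
  imports "HOL-Library.Infinite_Set"
begin

unbundle cardinal_syntax

text \<open>
  Cardinals are cardinal orders: \<open>|A|\<close> is the cardinality of \<open>A\<close>, \<open>natLeq\<close> is the cardinal
  \<open>\<omega>\<close>, and equality of cardinals (possibly living on different types) is \<open>=o\<close>.
  An ideal is represented by its set of members.
\<close>

text \<open>The least cardinality of a member of a nonempty family of sets.\<close>

definition min_card :: "'a set set \<Rightarrow> 'a rel" where
  "min_card F = |SOME A. A \<in> F \<and> (\<forall>B\<in>F. |A| \<le>o |B| )|"

lemma min_card_attained:
  assumes "F \<noteq> {}"
  shows "\<exists>A\<in>F. min_card F = |A| \<and> (\<forall>B\<in>F. |A| \<le>o |B| )"
proof -
  have "\<exists>r\<in>card_of ` F. \<forall>r'\<in>card_of ` F. r \<le>o r'"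
    using assms by (intro exists_minim_Card_order) (auto simp: card_of_Card_order)
  then have "\<exists>A. A \<in> F \<and> (\<forall>B\<in>F. |A| \<le>o |B| )"
    by auto
  from someI_ex[OF this] show ?thesis
    unfolding min_card_def by blast
qed

definition cof :: "'a set set \<Rightarrow> 'a set set \<Rightarrow> 'a set rel" where
  "cof J I = min_card {\<A>. \<A> \<subseteq> I \<and> (\<forall>X\<in>I. \<exists>A\<in>\<A>. X - A \<in> J)}"

lemma cof_family_nonempty:
  assumes "{} \<in> J"
  shows "{\<A>. \<A> \<subseteq> I \<and> (\<forall>X\<in>I. \<exists>A\<in>\<A>. X - A \<in> J)} \<noteq> {}"
proof -
  have "I \<in> {\<A>. \<A> \<subseteq> I \<and> (\<forall>X\<in>I. \<exists>A\<in>\<A>. X - A \<in> J)}"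
    using assms by (auto intro!: bexI)
  then show ?thesis by blast
qed

definition dominating :: "(nat \<Rightarrow> nat) set \<Rightarrow> bool" where
  "dominating D \<longleftrightarrow> (\<forall>f. \<exists>g\<in>D. \<forall>\<^sub>\<infinity>n. f n \<le> g n)"

definition dominating_number :: "(nat \<Rightarrow> nat) rel" where
  "dominating_number = min_card {D. dominating D}"

lemma dominating_family_nonempty: "{D. dominating D} \<noteq> {}"
proof -
  have "dominating UNIV"
    unfolding dominating_def by (intro allI bexI[OF _ UNIV_I] ALL_MOST) (rule order_refl)
  then show ?thesis by blast
qed

definition continuum :: "(nat \<Rightarrow> bool) rel" where
  "continuum = ctwo ^c natLeq"

definition sect :: "(nat \<times> nat) set \<Rightarrow> nat \<Rightarrow> nat set" where
  "sect X n = {m. (n, m) \<in> X}"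

definition Fin_empty :: "(nat \<times> nat) set set" where
  "Fin_empty = {X. \<forall>\<^sub>\<infinity>n. sect X n = {}}"

definition empty_Fin :: "(nat \<times> nat) set set" where
  "empty_Fin = {X. \<forall>n. finite (sect X n)}"

definition Fin_Fin :: "(nat \<times> nat) set set" where
  "Fin_Fin = {X. \<forall>\<^sub>\<infinity>n. finite (sect X n)}"

text \<open>
  As \<open>card\<close> is 0 on infinite sets, the condition that a section has fewer than \<open>k\<close> elements
  needs an explicit finiteness requirement.
\<close>

definition Sel :: "(nat \<times> nat) set set" where
  "Sel = {X. \<exists>k. \<forall>n. finite (sect X n) \<and> card (sect X n) < k}"

definition ED :: "(nat \<times> nat) set set" where
  "ED = {X. \<exists>k. \<forall>\<^sub>\<infinity>n. finite (sect X n) \<and> card (sect X n) < k}"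

end

theory Submission
  imports Defs "HOL-Library.Countable"
begin

text \<open>
  The vertical strips \<open>{..<n} \<times> UNIV\<close> witness all the countable upper bounds, while a finite family in
  \<open>Fin_Fin\<close> misses infinitely much of some column. For \<open>Fin_Fin\<close> modulo \<open>Sel\<close>, the cardinalities
  of the sections turn a cofinal family into a dominating one, because the region below
  \<open>n \<mapsto> f n + n\<close> eventually has more than \<open>f n + k\<close> points in each column, whatever \<open>k\<close> is.
  Modulo \<open>Fin_empty\<close>, each branch of the binary tree gives a selector, coding its initial segments,
  and distinct branches give eventually disjoint selectors. Hence each member of \<open>ED\<close> almost
  covers only finitely many of them.
\<close>

section \<open>Minimal cardinalities: upper bounds and attainment\<close>

lemma min_card_le:
  assumes "A \<in> F"
  shows "min_card F \<le>o |A|"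
proof -
  obtain B where "min_card F = |B|" "\<forall>C\<in>F. |B| \<le>o |C|"
    using min_card_attained[of F] assms by blast
  then show ?thesis
    using assms by simp
qed

lemma cof_le:
  assumes "\<A> \<subseteq> I" "\<And>X. X \<in> I \<Longrightarrow> \<exists>A\<in>\<A>. X - A \<in> J"
  shows "cof J I \<le>o |\<A>|"
  unfolding cof_def by (rule min_card_le) (use assms in blast)

text \<open>Since \<open>{}\<close> lies in \<open>J\<close>, the family \<open>I\<close> itself is
  admissible, so the minimum is taken over a nonempty collection.\<close>

lemma cof_attained:
  assumes "{} \<in> J"
  obtains \<A> where "\<A> \<subseteq> I" "\<And>X. X \<in> I \<Longrightarrow> \<exists>A\<in>\<A>. X - A \<in> J" "cof J I = |\<A>|"
proof -
  obtain \<A> where "\<A> \<in> {\<A>. \<A> \<subseteq> I \<and> (\<forall>X\<in>I. \<exists>A\<in>\<A>. X - A \<in> J)}" "cof J I = |\<A>|"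
    using min_card_attained[OF cof_family_nonempty[OF assms, of I]] unfolding cof_def by (elim bexE conjE)
  then show ?thesis
    by (intro that[of \<A>]) simp_all
qed

lemma dominating_number_le:
  assumes "dominating D"
  shows "dominating_number \<le>o |D|"
  unfolding dominating_number_def by (rule min_card_le) (use assms in blast)

lemma dominating_number_attained:
  obtains D where "dominating D" "dominating_number = |D|"
  using min_card_attained[OF dominating_family_nonempty]
  unfolding dominating_number_def by (elim bexE conjE) simp

text \<open>On the domain \<open>UNIV\<close> the condition in \<open>Func\<close> about values off
  the domain is vacuous, so \<open>cexp\<close> yields the full function type.\<close>

lemma continuum_eq: "continuum = |UNIV|"
proof -
  have "Func UNIV (UNIV :: bool set) = (UNIV :: (nat \<Rightarrow> bool) set)"
    by (auto simp: Func_def)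
  then show ?thesis
    by (simp add: continuum_def cexp_def ctwo_def Field_natLeq Field_card_of)
qed

section \<open>Sections and inclusions between the ideals\<close>

lemma sect_Diff [simp]: "sect (X - Y) n = sect X n - sect Y n"
  by (auto simp: sect_def)

lemma sect_empty [simp]: "sect {} n = {}"
  by (simp add: sect_def)

lemma sect_Times [simp]: "sect (S \<times> T) n = (if n \<in> S then T else {})"
  by (auto simp: sect_def)

lemma empty_in_Fin_empty: "{} \<in> Fin_empty"
  by (simp add: Fin_empty_def)

lemma empty_in_Sel: "{} \<in> Sel"
  by (auto simp: Sel_def)

lemma Sel_subset_empty_Fin: "Sel \<subseteq> empty_Fin"
  by (auto simp: Sel_def empty_Fin_def)

lemma empty_in_empty_Fin: "{} \<in> empty_Fin"
  using empty_in_Sel Sel_subset_empty_Fin by blast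

lemma Sel_subset_ED: "Sel \<subseteq> ED"
  unfolding Sel_def ED_def using ALL_MOST by blast

lemma Fin_empty_subset_ED: "Fin_empty \<subseteq> ED"
proof
  fix X assume "X \<in> Fin_empty"
  then have "\<forall>\<^sub>\<infinity>n. finite (sect X n) \<and> card (sect X n) < 1"
    unfolding Fin_empty_def by (auto elim: eventually_mono)
  then show "X \<in> ED"
    unfolding ED_def by blast
qed

lemma ED_subset_Fin_Fin: "ED \<subseteq> Fin_Fin"
  unfolding ED_def Fin_Fin_def by (auto elim: eventually_mono)

section \<open>Strips, columns and the countable values\<close>

lemma strip_in_Fin_empty: "{..<n} \<times> UNIV \<in> Fin_empty"
  unfolding Fin_empty_def MOST_nat by (auto intro!: exI[of _ n])

lemma column_in_Fin_empty: "{n} \<times> UNIV \<in> Fin_empty"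
  unfolding Fin_empty_def MOST_nat by (auto intro!: exI[of _ n])

text \<open>A long enough strip leaves nothing over. Membership in \<open>Sel\<close> is recorded
  because it also gives membership in \<open>empty_Fin\<close>.\<close>

lemma Fin_empty_minus_strip:
  assumes "X \<in> Fin_empty"
  shows "\<exists>n. X - {..<n} \<times> UNIV \<in> Sel"
proof -
  obtain N where N: "\<And>n. n \<ge> N \<Longrightarrow> sect X n = {}"
    using assms unfolding Fin_empty_def MOST_nat_le by auto
  have "finite (sect (X - {..<N} \<times> UNIV) n) \<and> card (sect (X - {..<N} \<times> UNIV) n) < 1" for n
    using N[of n] by auto
  then show ?thesis
    unfolding Sel_def by blast
qed

lemma ED_minus_strip:
  assumes "X \<in> ED"
  shows "\<exists>n. X - {..<n} \<times> UNIV \<in> Sel"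
proof -
  obtain k N where N: "\<And>n. n \<ge> N \<Longrightarrow> finite (sect X n) \<and> card (sect X n) < k"
    using assms unfolding ED_def MOST_nat_le by auto
  \<comment> \<open>Columns inside the strip become empty, and their cardinality 0 must lie strictly
    below the bound.\<close>
  have "0 < k"
    using N[of N] by simp
  then have "finite (sect (X - {..<N} \<times> UNIV) n) \<and> card (sect (X - {..<N} \<times> UNIV) n) < k" for n
    using N[of n] by auto
  then show ?thesis
    unfolding Sel_def by blast
qed

lemma Fin_Fin_minus_strip:
  assumes "X \<in> Fin_Fin"
  shows "\<exists>n. X - {..<n} \<times> UNIV \<in> empty_Fin"
proof -
  obtain N where N: "\<And>n. n \<ge> N \<Longrightarrow> finite (sect X n)"
    using assms unfolding Fin_Fin_def MOST_nat_le by auto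
  have "X - {..<N} \<times> UNIV \<in> empty_Fin"
    using N by (auto simp: empty_Fin_def)
  then show ?thesis ..
qed

lemma cof_le_natLeq:
  assumes "Fin_empty \<subseteq> I" "\<And>X. X \<in> I \<Longrightarrow> \<exists>n. X - {..<n} \<times> UNIV \<in> J"
  shows "cof J I \<le>o natLeq"
proof -
  let ?S = "range (\<lambda>n::nat. {..<n} \<times> (UNIV :: nat set))"
  have "cof J I \<le>o |?S|"
    using assms strip_in_Fin_empty by (intro cof_le) auto
  also have "|?S| \<le>o |UNIV :: nat set|"
    by (rule card_of_image)
  also have "|UNIV :: nat set| =o natLeq"
    by (rule card_of_nat)
  finally show ?thesis .
qed

text \<open>Past the exceptional columns of finitely many members all their sections are finite, yet
  covering such a column needs a cofinite one.\<close>

lemma infinite_if_covers_columns: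
  assumes "\<A> \<subseteq> Fin_Fin" "\<And>n. \<exists>A\<in>\<A>. {n} \<times> UNIV - A \<in> empty_Fin"
  shows "infinite \<A>"
proof
  assume "finite \<A>"
  then have "\<forall>\<^sub>\<infinity>n. \<forall>A\<in>\<A>. finite (sect A n)"
    using assms(1) by (intro eventually_ball_finite) (auto simp: Fin_Fin_def)
  then obtain n where n: "\<forall>A\<in>\<A>. finite (sect A n)"
    unfolding MOST_nat_le by blast
  obtain A where "A \<in> \<A>" "{n} \<times> UNIV - A \<in> empty_Fin"
    using assms(2) by blast
  then have "finite (sect ({n} \<times> UNIV - A) n)"
    unfolding empty_Fin_def by blast
  then have "finite (UNIV - sect A n)"
    by simp
  then show False
    using n \<open>A \<in> \<A>\<close> finite_Diff2 infinite_UNIV_nat by blast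
qed

lemma natLeq_le_cof:
  assumes "{} \<in> J" "J \<subseteq> empty_Fin" "Fin_empty \<subseteq> I" "I \<subseteq> Fin_Fin"
  shows "natLeq \<le>o cof J I"
proof -
  obtain \<A> where \<A>: "\<A> \<subseteq> I" "\<And>X. X \<in> I \<Longrightarrow> \<exists>A\<in>\<A>. X - A \<in> J" "cof J I = |\<A>|"
    using cof_attained[OF assms(1)] by blast
  have "\<exists>A\<in>\<A>. {n} \<times> UNIV - A \<in> empty_Fin" for n
    using \<A>(2)[of "{n} \<times> UNIV"] column_in_Fin_empty assms(2,3) by blast
  then have "infinite \<A>"
    using \<A>(1) assms(4) by (intro infinite_if_covers_columns) auto
  then show ?thesis
    using \<A>(3) infinite_iff_natLeq_ordLeq by metis
qed

text \<open>Common source of all five countable values: strips and columns lie in \<open>I\<close>,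
  and remainders in \<open>J\<close> have finite sections.\<close>

lemma cof_eq_natLeq:
  assumes "{} \<in> J" "J \<subseteq> empty_Fin" "Fin_empty \<subseteq> I" "I \<subseteq> Fin_Fin"
    and "\<And>X. X \<in> I \<Longrightarrow> \<exists>n. X - {..<n} \<times> UNIV \<in> J"
  shows "cof J I =o natLeq"
  using cof_le_natLeq[OF assms(3,5)] natLeq_le_cof[OF assms(1-4)]
  by (simp add: ordIso_iff_ordLeq)

section \<open>\<open>Fin_Fin\<close> modulo \<open>Sel\<close> and the dominating number\<close>

lemma infinite_dominating:
  assumes "dominating D"
  shows "infinite D"
proof
  assume "finite D"
  \<comment> \<open>The successor of the pointwise sum exceeds every member of a finite
    \<open>D\<close> everywhere.\<close>
  obtain g where "g \<in> D" "\<forall>\<^sub>\<infinity>n. Suc (\<Sum>h\<in>D. h n) \<le> g n"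
    using assms unfolding dominating_def by meson
  then obtain n where "Suc (\<Sum>h\<in>D. h n) \<le> g n"
    unfolding MOST_nat_le by blast
  moreover have "g n \<le> (\<Sum>h\<in>D. h n)"
    using \<open>finite D\<close> \<open>g \<in> D\<close> by (intro member_le_sum) auto
  ultimately show False
    by simp
qed

text \<open>Finitely many full columns together with the region under a function from
  \<open>D\<close> contain any given member of \<open>Fin_Fin\<close>, so the remainder is even
  empty.\<close>

lemma cof_Sel_Fin_Fin_le: "cof Sel Fin_Fin \<le>o dominating_number"
proof -
  obtain D where D: "dominating D" "dominating_number = |D|"
    using dominating_number_attained .
  define B :: "(nat \<Rightarrow> nat) \<times> nat \<Rightarrow> (nat \<times> nat) set"
    where "B = (\<lambda>(g, N). {(n, m). n < N \<or> m \<le> g n})"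
  have sect_B: "sect (B (g, N)) n = (if n < N then UNIV else {..g n})" for g N n
    by (auto simp: B_def sect_def)
  have "cof Sel Fin_Fin \<le>o |B ` (D \<times> UNIV)|"
  proof (rule cof_le)
    show "B ` (D \<times> UNIV) \<subseteq> Fin_Fin"
    proof clarify
      fix g N
      have "\<forall>n\<ge>N. finite (sect (B (g, N)) n)"
        by (simp add: sect_B)
      then show "B (g, N) \<in> Fin_Fin"
        unfolding Fin_Fin_def MOST_nat_le by blast
    qed
  next
    fix X assume "X \<in> Fin_Fin"
    then obtain N where N: "\<And>n. n \<ge> N \<Longrightarrow> finite (sect X n)"
      unfolding Fin_Fin_def MOST_nat_le by auto
    \<comment> \<open>\<open>insert 0\<close> gives \<open>Max\<close> a value on empty sections;
      the columns \<open>n < N\<close>, whose sections may be infinite, will be included in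
      full.\<close>
    obtain g where "g \<in> D" "\<forall>\<^sub>\<infinity>n. Max (insert 0 (sect X n)) \<le> g n"
      using D(1) unfolding dominating_def by meson
    then obtain M where M: "\<And>n. n \<ge> M \<Longrightarrow> Max (insert 0 (sect X n)) \<le> g n"
      unfolding MOST_nat_le by auto
    have "sect X n \<subseteq> {..g n}" if "n \<ge> max N M" for n
      using M[of n] N[of n] that by auto
    then have "sect (X - B (g, max N M)) n = {}" for n
      by (auto simp: sect_B less_max_iff_disj not_less)
    then have "X - B (g, max N M) \<in> Sel"
      unfolding Sel_def by (auto simp del: sect_Diff)
    then show "\<exists>A\<in>B ` (D \<times> UNIV). X - A \<in> Sel"
      using \<open>g \<in> D\<close> by blast
  qed
  also have "|B ` (D \<times> UNIV)| \<le>o |D \<times> (UNIV :: nat set)|"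
    by (rule card_of_image)
  \<comment> \<open>The infinite set \<open>D\<close> absorbs the countable factor of strip
    lengths.\<close>
  also have "|D \<times> (UNIV :: nat set)| \<le>o |D|"
    using infinite_dominating[OF D(1)] infinite_iff_card_of_nat[of D]
    by (intro card_of_Sigma_ordLeq_infinite ballI card_of_mono1 subset_refl) blast+
  finally show ?thesis
    using D(2) by simp
qed

lemma dominating_sections:
  assumes "\<A> \<subseteq> Fin_Fin" "\<And>X. X \<in> Fin_Fin \<Longrightarrow> \<exists>A\<in>\<A>. X - A \<in> Sel"
  shows "dominating ((\<lambda>A n. card (sect A n)) ` \<A>)"
  unfolding dominating_def
proof
  fix f :: "nat \<Rightarrow> nat"
  \<comment> \<open>The summand \<open>n\<close> eventually outgrows the constant \<open>k\<close>,
    which depends on the set \<open>A\<close> chosen afterwards.\<close>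
  let ?X = "{(n, m). m < f n + n}"
  have sect_X: "sect ?X n = {..<f n + n}" for n
    by (auto simp: sect_def)
  have "?X \<in> Fin_Fin"
    by (simp add: Fin_Fin_def sect_X)
  then obtain A where A: "A \<in> \<A>" "?X - A \<in> Sel"
    using assms(2) by blast
  then obtain k where k: "\<And>n. card ({..<f n + n} - sect A n) < k"
    by (auto simp: Sel_def sect_X)
  \<comment> \<open>As \<open>card\<close> is 0 on infinite sets, the count is confined to columns
    where \<open>A\<close> has a finite section.\<close>
  have "\<forall>\<^sub>\<infinity>n. finite (sect A n)"
    using A(1) assms(1) by (auto simp: Fin_Fin_def)
  then have "\<forall>\<^sub>\<infinity>n. finite (sect A n) \<and> k \<le> n"
    by (simp add: MOST_ge_nat eventually_conj)
  then have "\<forall>\<^sub>\<infinity>n. f n \<le> card (sect A n)"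
  proof (rule eventually_mono)
    fix n assume n: "finite (sect A n) \<and> k \<le> n"
    then have "f n + n \<le> card ({..<f n + n} - sect A n) + card (sect A n)"
      using diff_card_le_card_Diff[of "sect A n" "{..<f n + n}"] by simp
    then show "f n \<le> card (sect A n)"
      using k[of n] n by linarith
  qed
  then show "\<exists>g\<in>(\<lambda>A n. card (sect A n)) ` \<A>. \<forall>\<^sub>\<infinity>n. f n \<le> g n"
    using A(1) by auto
qed

lemma dominating_number_le_cof: "dominating_number \<le>o cof Sel Fin_Fin"
proof -
  obtain \<A> where \<A>: "\<A> \<subseteq> Fin_Fin" "\<And>X. X \<in> Fin_Fin \<Longrightarrow> \<exists>A\<in>\<A>. X - A \<in> Sel"
    "cof Sel Fin_Fin = |\<A>|"
    using cof_attained[OF empty_in_Sel] by blast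
  have "dominating_number \<le>o |(\<lambda>A n. card (sect A n)) ` \<A>|"
    by (intro dominating_number_le dominating_sections \<A>)
  also have "|(\<lambda>A n. card (sect A n)) ` \<A>| \<le>o |\<A>|"
    by (rule card_of_image)
  finally show ?thesis
    using \<A>(3) by simp
qed

section \<open>Branches as selectors and the values equal to the continuum\<close>

definition branch_code :: "(nat \<Rightarrow> bool) \<Rightarrow> nat \<Rightarrow> nat" where
  "branch_code x n = to_nat (map x [0..<n])"

definition branch_graph :: "(nat \<Rightarrow> bool) \<Rightarrow> (nat \<times> nat) set" where
  "branch_graph x = {(n, branch_code x n) | n. True}"

lemma sect_branch_graph: "sect (branch_graph x) n = {branch_code x n}"
  by (auto simp: sect_def branch_graph_def)

lemma branch_graph_in_Sel: "branch_graph x \<in> Sel"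
  unfolding Sel_def by (auto simp: sect_branch_graph intro!: exI[of _ 2])

lemma MOST_branch_code_neq:
  assumes "x \<noteq> y"
  shows "\<forall>\<^sub>\<infinity>n. branch_code x n \<noteq> branch_code y n"
proof -
  obtain i where "x i \<noteq> y i"
    using assms by blast
  \<comment> \<open>An initial segment of length \<open>n\<close> contains position \<open>i\<close>
    only if \<open>i < n\<close>; from there on the injectivity of \<open>to_nat\<close> separates
    the codes.\<close>
  then have "\<forall>n>i. branch_code x n \<noteq> branch_code y n"
    by (auto simp: branch_code_def)
  then show ?thesis
    unfolding MOST_nat by blast
qed

lemma MOST_inj_on_branch_code:
  assumes "finite F"
  shows "\<forall>\<^sub>\<infinity>n. inj_on (\<lambda>x. branch_code x n) F"
proof -
  have "\<forall>\<^sub>\<infinity>n. x \<noteq> y \<longrightarrow> branch_code x n \<noteq> branch_code y n" for x y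
    using MOST_branch_code_neq by (cases "x = y") auto
  then have "\<forall>\<^sub>\<infinity>n. \<forall>x\<in>F. \<forall>y\<in>F. x \<noteq> y \<longrightarrow> branch_code x n \<noteq> branch_code y n"
    using assms by (intro eventually_ball_finite ballI) auto
  then show ?thesis
    by (rule eventually_mono) (auto simp: inj_on_def)
qed

text \<open>If \<open>k\<close> branches were almost covered, a late column would hold
  \<open>k\<close> distinct codes in a section with fewer than \<open>k\<close> points.\<close>

lemma finite_branches_almost_in_ED:
  assumes "A \<in> ED"
  shows "finite {x. branch_graph x - A \<in> Fin_empty}"
proof (rule ccontr)
  obtain k where k: "\<forall>\<^sub>\<infinity>n. finite (sect A n) \<and> card (sect A n) < k"
    using assms unfolding ED_def by blast
  assume "infinite {x. branch_graph x - A \<in> Fin_empty}"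
  then obtain F where F: "finite F" "card F = k" "F \<subseteq> {x. branch_graph x - A \<in> Fin_empty}"
    using infinite_arbitrarily_large by blast
  have "\<forall>\<^sub>\<infinity>n. branch_code x n \<in> sect A n" if "x \<in> F" for x
    using F(3) that by (auto simp: Fin_empty_def sect_branch_graph elim: eventually_mono)
  then have "\<forall>\<^sub>\<infinity>n. \<forall>x\<in>F. branch_code x n \<in> sect A n"
    using F(1) by (intro eventually_ball_finite) auto
  with k MOST_inj_on_branch_code[OF F(1)]
  have "\<forall>\<^sub>\<infinity>n. (finite (sect A n) \<and> card (sect A n) < k) \<and> inj_on (\<lambda>x. branch_code x n) F \<and>
      (\<forall>x\<in>F. branch_code x n \<in> sect A n)"
    by (simp add: eventually_conj_iff)
  then obtain n where n: "finite (sect A n)" "card (sect A n) < k"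
    "inj_on (\<lambda>x. branch_code x n) F" "\<forall>x\<in>F. branch_code x n \<in> sect A n"
    unfolding MOST_nat_le by blast
  have "card F \<le> card (sect A n)"
    using n by (intro card_inj_on_le[of "\<lambda>x. branch_code x n"]) auto
  then show False
    using F(2) n(2) by simp
qed

text \<open>The finite sets \<open>C A\<close> cover the infinite set of all branches. Hence the
  family is infinite, and a union of finite sets indexed by it is no larger than the family.\<close>

lemma continuum_le_cof_Fin_empty:
  assumes "Sel \<subseteq> I" "I \<subseteq> ED"
  shows "continuum \<le>o cof Fin_empty I"
proof -
  obtain \<A> where \<A>: "\<A> \<subseteq> I" "\<And>X. X \<in> I \<Longrightarrow> \<exists>A\<in>\<A>. X - A \<in> Fin_empty"
    "cof Fin_empty I = |\<A>|"
    using cof_attained[OF empty_in_Fin_empty] by blast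
  define C where "C A = {x. branch_graph x - A \<in> Fin_empty}" for A
  have finite_C: "finite (C A)" if "A \<in> \<A>" for A
    using finite_branches_almost_in_ED that \<A>(1) assms(2) unfolding C_def by blast
  have UNIV_C: "UNIV = (\<Union>A\<in>\<A>. C A)"
    using \<A>(2) branch_graph_in_Sel assms(1) unfolding C_def by blast
  have "infinite (UNIV :: (nat \<Rightarrow> bool) set)"
    using finite_fun_UNIVD1[where 'a = nat and 'b = bool] by auto
  then have "infinite \<A>"
    using finite_C UNIV_C by (metis finite_UN_I)
  then have "|C A| \<le>o |\<A>|" if "A \<in> \<A>" for A
    using ordLeq_total[OF card_of_Well_order card_of_Well_order, of "C A" \<A>]
      card_of_ordLeq_finite[of \<A> "C A"] finite_C[OF that] by blast
  with \<open>infinite \<A>\<close> have "|\<Union>A\<in>\<A>. C A| \<le>o |\<A>|"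
    by (intro card_of_UNION_ordLeq_infinite card_of_mono1) auto
  then show ?thesis
    unfolding continuum_eq \<A>(3) UNIV_C[symmetric] .
qed

text \<open>The ideal itself is an admissible family, and its members inject into binary sequences
  as characteristic functions along \<open>prod_decode\<close>.\<close>

lemma cof_le_continuum:
  fixes I :: "(nat \<times> nat) set set"
  assumes "{} \<in> J"
  shows "cof J I \<le>o continuum"
proof -
  have "cof J I \<le>o |I|"
    using assms by (intro cof_le) (auto intro!: bexI)
  also have "|I| \<le>o |UNIV :: (nat \<Rightarrow> bool) set|"
  proof (intro card_of_ordLeqI[of "\<lambda>X i. prod_decode i \<in> X"] inj_onI)
    fix X Y :: "(nat \<times> nat) set"
    assume eq: "(\<lambda>i. prod_decode i \<in> X) = (\<lambda>i. prod_decode i \<in> Y)"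
    have "p \<in> X \<longleftrightarrow> p \<in> Y" for p
      using fun_cong[OF eq, of "prod_encode p"] by simp
    then show "X = Y"
      by blast
  qed simp
  finally show ?thesis
    unfolding continuum_eq .
qed

lemma cof_Fin_empty_eq_continuum:
  assumes "Sel \<subseteq> I" "I \<subseteq> ED"
  shows "cof Fin_empty I =o continuum"
  using cof_le_continuum[OF empty_in_Fin_empty] continuum_le_cof_Fin_empty[OF assms]
  by (simp add: ordIso_iff_ordLeq)

theorem theorem4p3:
  shows "(cof empty_Fin Fin_empty =o natLeq \<and> cof Sel Fin_empty =o natLeq) \<and>
    (cof empty_Fin Fin_Fin =o natLeq \<and> cof Sel Fin_Fin =o dominating_number) \<and>
    cof Fin_empty Sel =o continuum \<and>
    (cof Fin_empty ED =o continuum \<and> cof empty_Fin ED =o natLeq \<and> cof Sel ED =o natLeq)"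
proof (intro conjI)
  note subsets = Sel_subset_empty_Fin Sel_subset_ED Fin_empty_subset_ED ED_subset_Fin_Fin
  show "cof Sel Fin_empty =o natLeq"
    using subsets by (intro cof_eq_natLeq empty_in_Sel Fin_empty_minus_strip) auto
  show "cof empty_Fin Fin_empty =o natLeq"
    using subsets Fin_empty_minus_strip by (intro cof_eq_natLeq empty_in_empty_Fin) blast+
  show "cof empty_Fin Fin_Fin =o natLeq"
    using subsets by (intro cof_eq_natLeq empty_in_empty_Fin Fin_Fin_minus_strip) auto
  show "cof Sel Fin_Fin =o dominating_number"
    using cof_Sel_Fin_Fin_le dominating_number_le_cof by (simp add: ordIso_iff_ordLeq)
  show "cof Fin_empty Sel =o continuum"
    using Sel_subset_ED by (intro cof_Fin_empty_eq_continuum) auto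
  show "cof Fin_empty ED =o continuum"
    using Sel_subset_ED by (intro cof_Fin_empty_eq_continuum) auto
  show "cof empty_Fin ED =o natLeq"
    using subsets ED_minus_strip by (intro cof_eq_natLeq empty_in_empty_Fin) blast+
  show "cof Sel ED =o natLeq"
    using subsets by (intro cof_eq_natLeq empty_in_Sel ED_minus_strip) auto
qed

end
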